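(* Let $p$ be a prime, and let $\alpha,l,n\in\mathbb N$. Then, for all $r\in\mathbb Z$, we have $$\operatorname{ord}_p\left(\sum_{k\equiv r\ (\mathrm{mod}\ p^{\alpha})}\binom nk(-1)^k\left(\frac{k-r}{p^{\alpha}}\right)^l\right)-\operatorname{ord}_p\left(\left\lfloor\frac n{p^{\alpha}}\right\rfloor!\right)\ \ge\ \tau_p\bigl(\{r\}_{p^{\alpha}},\{n-r\}_{p^{\alpha}}\bigr)=\operatorname{ord}_p\binom{\{r\}_{p^{\alpha}}+\{n-r\}_{p^{\alpha}}}{\{r\}_{p^{\alpha}}}.$$
   Context: $\mathbb N=\{0,1,2,\ldots\}$. For a prime $p$ and an integer $m$, $\operatorname{ord}_p(m)=\sup\{a\in\mathbb N: p^a\mid m\}$ (so $\operatorname{ord}_p(0)=+\infty$). For $a\in\mathbb Z$ and a positive integer $m$, $\{a\}_m$ denotes the least nonnegative residue of $a$ modulo $m$. For $a,b\in\mathbb N$, $\tau_p(a,b)$ denotes the number of carries occurring in the addition of $a$ and $b$ in base $p$. The sum is over all integers $k$ with $k\equiv r\pmod{p^\alpha}$, where $\binom nk=0$ if $k<0$ or $k>n$; when $l=0$ the $l$-th power is read as $1$ (including $0^0=1$). *)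

theory Defs
  imports "HOL-Library.Extended_Real" "HOL-Number_Theory.Cong"
begin

text \<open>The \<^term>\<open>p\<close>-adic order, with value \<^term>\<open>\<infinity>\<close> at \<^term>\<open>0::int\<close>.\<close>

definition ordp :: "nat \<Rightarrow> int \<Rightarrow> enat" where
  "ordp p m = Sup {enat a | a. int p ^ a dvd m}"

definition least_residue :: "int \<Rightarrow> nat \<Rightarrow> nat" where
  "least_residue a m = nat (a mod int m)"

text \<open>\<open>carry p a b i\<close> is the carry \<^emph>\<open>into\<close> position \<open>i\<close> in the schoolbook addition of \<open>a\<close> and
  \<open>b\<close> in base \<open>p\<close>; position \<open>0\<close> is the units digit.\<close>

primrec carry :: "nat \<Rightarrow> nat \<Rightarrow> nat \<Rightarrow> nat \<Rightarrow> nat" where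
  "carry p a b 0 = 0"
| "carry p a b (Suc i) = (a div p ^ i mod p + b div p ^ i mod p + carry p a b i) div p"

definition num_carries :: "nat \<Rightarrow> nat \<Rightarrow> nat \<Rightarrow> nat" where
  "num_carries p a b = card {i. carry p a b (Suc i) \<noteq> 0}"

lemma carry_le_1:
  assumes "p \<ge> 2"
  shows "carry p a b i \<le> 1"
proof (induction i)
  case (Suc i)
  have "a div p ^ i mod p < p" "b div p ^ i mod p < p"
    using assms by simp_all
  then have "a div p ^ i mod p + b div p ^ i mod p + carry p a b i < 2 * p"
    using Suc by linarith
  then have "carry p a b (Suc i) < 2"
    by (simp add: less_mult_imp_div_less)
  then show ?case by linarith
qed simp

text \<open>Only finitely many carries occur, so that the cardinality above is meaningful.\<close>

lemma finite_carries:
  assumes "p \<ge> 2"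
  shows "finite {i. carry p a b (Suc i) \<noteq> 0}"
proof (rule finite_subset)
  show "{i. carry p a b (Suc i) \<noteq> 0} \<subseteq> {..a + b}"
  proof
    fix i assume i: "i \<in> {i. carry p a b (Suc i) \<noteq> 0}"
    show "i \<in> {..a + b}"
    proof (rule ccontr)
      assume "i \<notin> {..a + b}"
      then have "a + b < i" by simp
      moreover have "i < p ^ i"
        using assms by (intro power_gt_expt) simp
      ultimately have "a < p ^ i" "b < p ^ i" by linarith+
      then have "carry p a b (Suc i) = carry p a b i div p" by simp
      also have "\<dots> = 0"
        using carry_le_1[OF assms, of a b i] assms by simp
      finally show False using i by simp
    qed
  qed
qed simp

end

theory Submission
  imports Defs "HOL-Computational_Algebra.Polynomial"
begin

text \<open>Write \<open>q = p ^ \<alpha>\<close> and let \<open>S l n r\<close> be the sum. If \<open>L\<close> is the linear functional on integer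
  polynomials sending \<open>x ^ k\<close> to \<open>((k - r) / q) ^ l\<close> when \<open>q\<close> divides \<open>k - r\<close> and to \<open>0\<close> otherwise, then
  \<open>S l n r\<close> is the value of \<open>L\<close> at \<open>(1 - x) ^ n\<close>. Since \<open>(1 - x) ^ p = 1 - x ^ p + p h\<close>, expanding in powers
  of \<open>1 - x ^ p\<close> reduces \<open>\<alpha>\<close> by one, and induction on \<open>\<alpha>\<close> shows that the \<open>p\<close>-part of
  \<open>fact (n div q)\<close> divides \<open>S l n r\<close>. The identity \<open>k * (n choose k) = n * (n - 1 choose k - 1)\<close> gives
  \<open>r * S l n r = - n * S l (n - 1) (r - 1) - q * S (l + 1) n r\<close>, and induction on \<open>n\<close> then
  supplies the binomial coefficient of the two residues, whose order is the number of carries by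
  Kummer's theorem.\<close>

lemma div_Suc_dvd: "q dvd Suc n \<Longrightarrow> Suc n div q = Suc (n div q)"
  by (simp add: div_Suc mod_eq_0_iff_dvd)

lemma div_Suc_not_dvd: "\<not> q dvd Suc n \<Longrightarrow> Suc n div q = n div q"
  by (simp add: div_Suc mod_eq_0_iff_dvd)

section \<open>Legendre's formula and Kummer's theorem\<close>

lemma dvd_power_iff_le_multiplicity:
  fixes m :: int
  assumes "prime p" "m \<noteq> 0"
  shows "int p ^ a dvd m \<longleftrightarrow> a \<le> multiplicity (int p) m"
proof -
  have "\<not> is_unit (int p)"
    using assms(1) by auto
  then show ?thesis
    using assms(2) by (intro power_dvd_iff_le_multiplicity) auto
qed

lemma multiplicity_mult_int:
  fixes x y :: int
  assumes "prime p" "x \<noteq> 0" "y \<noteq> 0"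
  shows "multiplicity (int p) (x * y) = multiplicity (int p) x + multiplicity (int p) y"
  using assms by (intro prime_elem_multiplicity_mult_distrib) auto

lemma ordp_eq_multiplicity:
  assumes "prime p" "m \<noteq> 0"
  shows "ordp p m = enat (multiplicity (int p) m)"
proof -
  have "{enat a | a. int p ^ a dvd m} = enat ` {..multiplicity (int p) m}"
    using dvd_power_iff_le_multiplicity[OF assms] by auto
  then show ?thesis
    unfolding ordp_def by (auto intro!: cSup_eq_maximum)
qed

lemma ordp_zero: "ordp p 0 = \<infinity>"
proof -
  have "infinite (range enat)"
    by (intro range_inj_infinite injI) auto
  moreover have "{enat a | a. int p ^ a dvd 0} = range enat"
    by auto
  ultimately show ?thesis
    by (simp add: ordp_def Sup_enat_def)
qed

text \<open>Only multiples of \<open>p\<close> contribute to the order: the factor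
  \<open>p * t\<close> contributes one more than \<open>t\<close>, and these \<open>t\<close> make
  up \<open>fact (n div p)\<close>.\<close>

lemma multiplicity_fact_div:
  assumes "prime p"
  shows "multiplicity (int p) (fact n) = n div p + multiplicity (int p) (fact (n div p))"
proof (induction n)
  case (Suc n)
  have eq: "multiplicity (int p) (fact (Suc k)) =
      multiplicity (int p) (int (Suc k)) + multiplicity (int p) (fact k)" for k
    using multiplicity_mult_int[OF assms, of "int (Suc k)" "fact k"] by simp
  show ?case
  proof (cases "p dvd Suc n")
    case True
    then have d: "Suc n div p = Suc (n div p)"
      by (rule div_Suc_dvd)
    then have "int (Suc n) = int p * int (Suc (n div p))"
      using True by (metis dvd_mult_div_cancel of_nat_mult)
    then have "multiplicity (int p) (int (Suc n)) = Suc (multiplicity (int p) (int (Suc (n div p))))"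
      using multiplicity_mult_int[OF assms, of "int p" "int (Suc (n div p))"] assms
      by (auto simp: prime_gt_0_nat)
    then show ?thesis
      unfolding d eq using Suc.IH by simp
  next
    case False
    then have "\<not> int p dvd int (Suc n)"
      using int_dvd_int_iff by blast
    then have "multiplicity (int p) (int (Suc n)) = 0"
      by (rule not_dvd_imp_multiplicity_0)
    moreover have "Suc n div p = n div p"
      using False by (rule div_Suc_not_dvd)
    ultimately show ?thesis
      unfolding eq using Suc.IH by simp
  qed
qed simp

lemma legendre_formula:
  assumes "prime p" "n < p ^ N"
  shows "multiplicity (int p) (fact n) = (\<Sum>i<N. n div p ^ Suc i)"
  using assms(2)
proof (induction N arbitrary: n)
  case (Suc N)
  have "n div p < p ^ N"
    using Suc.prems by (simp add: less_mult_imp_div_less mult.commute)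
  from Suc.IH[OF this] show ?case
    using multiplicity_fact_div[OF assms(1), of n]
    by (simp add: sum.lessThan_Suc_shift div_mult2_eq del: sum.lessThan_Suc)
qed simp

text \<open>This crude bound lets a factor \<open>p ^ i\<close> absorb the order of
  \<open>fact i\<close>. The induction closes because \<open>n div p\<close> is at most half of
  \<open>n\<close>.\<close>

lemma multiplicity_fact_le:
  assumes "prime p"
  shows "multiplicity (int p) (fact n) \<le> n"
proof (induction n rule: less_induct)
  case (less n)
  show ?case
  proof (cases "n = 0")
    case False
    have "2 * (n div p) \<le> p * (n div p)"
      using prime_ge_2_nat[OF assms] by simp
    also have "\<dots> \<le> n"
      by simp
    finally have "2 * (n div p) \<le> n" .
    moreover have "n div p < n"
      using False prime_ge_2_nat[OF assms] by simp
    ultimately show ?thesis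
      using less.IH[of "n div p"] multiplicity_fact_div[OF assms, of n] by linarith
  qed simp
qed

lemma mod_power_Suc:
  fixes a p :: nat
  shows "a mod p ^ Suc i = a mod p ^ i + p ^ i * (a div p ^ i mod p)"
  unfolding power_Suc2 mod_mult2_eq by simp

text \<open>The carry into position \<open>i\<close> is the overflow from adding the lowest
  \<open>i\<close> digits. This closed form links carries to the quotients in Legendre's
  formula.\<close>

lemma carry_eq_div:
  assumes "prime p"
  shows "carry p a b i = (a mod p ^ i + b mod p ^ i) div p ^ i"
proof (induction i)
  case (Suc i)
  let ?q = "p ^ i"
  let ?x = "a mod ?q + b mod ?q" and ?y = "a div ?q mod p + b div ?q mod p"
  have q: "?q > 0"
    using assms prime_gt_0_nat by simp
  have "a mod p ^ Suc i + b mod p ^ Suc i = ?x + ?q * ?y"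
    unfolding mod_power_Suc by (simp add: algebra_simps)
  then have "(a mod p ^ Suc i + b mod p ^ Suc i) div p ^ Suc i = ((?x + ?q * ?y) div ?q) div p"
    by (simp add: div_mult2_eq[symmetric] mult.commute)
  also have "(?x + ?q * ?y) div ?q = ?y + ?x div ?q"
    using q by simp
  finally show ?case
    using Suc.IH by simp
qed simp

text \<open>By Legendre's formula applied to \<open>fact (a + b)\<close>, \<open>fact a\<close> and
  \<open>fact b\<close>, the order of the binomial coefficient is the sum of the carries, each of
  which is 0 or 1.\<close>

theorem kummer:
  assumes "prime p"
  shows "num_carries p a b = multiplicity (int p) (int ((a + b) choose a))"
proof -
  \<comment> \<open>Beyond this cutoff all quotients by powers of \<open>p\<close> and all carries
    vanish, since \<open>a + b < p ^ N\<close>.\<close>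
  define N where "N = Suc (a + b)"
  have p2: "p \<ge> 2"
    using assms by (rule prime_ge_2_nat)
  have less: "k < p ^ N" if "k \<le> a + b" for k
  proof -
    have "N < p ^ N"
      using p2 by (intro power_gt_expt) simp
    then show ?thesis
      using that unfolding N_def by linarith
  qed
  have div_add: "(a + b) div p ^ i = a div p ^ i + b div p ^ i + carry p a b i" for i
    unfolding carry_eq_div[OF assms] by (rule div_add1_eq)
  have "fact (a + b) = (fact a * fact b * int ((a + b) choose a))"
    using binomial_fact_lemma[of a "a + b"] by (metis add_diff_cancel_left' le_add1 of_nat_fact of_nat_mult)
  then have "multiplicity (int p) (fact (a + b)) =
      multiplicity (int p) (fact a) + multiplicity (int p) (fact b)
        + multiplicity (int p) (int ((a + b) choose a))"
    using assms by (simp add: multiplicity_mult_int)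
  moreover have "multiplicity (int p) (fact (a + b)) =
      multiplicity (int p) (fact a) + multiplicity (int p) (fact b) + (\<Sum>i<N. carry p a b (Suc i))"
    using legendre_formula[OF assms less] div_add
    by (simp add: sum.distrib[symmetric] del: carry.simps power_Suc)
  moreover have "(\<Sum>i<N. carry p a b (Suc i)) = num_carries p a b"
  proof -
    have "i < N" if "carry p a b (Suc i) \<noteq> 0" for i
    proof (rule ccontr)
      assume "\<not> i < N"
      then have "p ^ N \<le> p ^ Suc i"
        using p2 by (intro power_increasing) auto
      then have "a + b < p ^ Suc i"
        using less[of "a + b"] by linarith
      then show False
        using that unfolding carry_eq_div[OF assms] by simp
    qed
    then have subset: "{i. carry p a b (Suc i) \<noteq> 0} \<subseteq> {..<N}"
      unfolding subset_iff mem_Collect_eq lessThan_iff by blast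
    have "(\<Sum>i<N. carry p a b (Suc i)) = (\<Sum>i<N. if carry p a b (Suc i) \<noteq> 0 then 1 else 0)"
    proof (intro sum.cong refl)
      fix i
      show "carry p a b (Suc i) = (if carry p a b (Suc i) \<noteq> 0 then 1 else 0)"
        using carry_le_1[OF p2, of a b "Suc i"] by (auto simp del: carry.simps)
    qed
    also have "\<dots> = card ({..<N} \<inter> {i. carry p a b (Suc i) \<noteq> 0})"
      by (subst sum.If_cases) (auto simp del: carry.simps)
    also have "{..<N} \<inter> {i. carry p a b (Suc i) \<noteq> 0} = {i. carry p a b (Suc i) \<noteq> 0}"
      using subset by (rule Int_absorb1)
    finally show ?thesis
      unfolding num_carries_def .
  qed
  ultimately show ?thesis
    by (simp only: add_left_cancel)
qed

section \<open>Weighted alternating binomial sums\<close>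

definition altsum :: "nat \<Rightarrow> (nat \<Rightarrow> int) \<Rightarrow> int" where
  "altsum n w = (\<Sum>k\<le>n. int (n choose k) * (- 1) ^ k * w k)"

lemma altsum_add: "altsum n (\<lambda>k. v k + w k) = altsum n v + altsum n w"
  by (simp add: altsum_def algebra_simps sum.distrib)

lemma altsum_cmult: "altsum n (\<lambda>k. c * w k) = c * altsum n w"
  by (simp add: altsum_def sum_distrib_left algebra_simps)

lemma altsum_index_mult:
  "altsum (Suc n) (\<lambda>k. int k * w k) = - int (Suc n) * altsum n (\<lambda>k. w (Suc k))"
proof -
  have "altsum (Suc n) (\<lambda>k. int k * w k) =
      (\<Sum>k\<le>n. int (Suc n choose Suc k) * (- 1) ^ Suc k * (int (Suc k) * w (Suc k)))"
    unfolding altsum_def by (simp add: sum.atMost_Suc_shift del: binomial_Suc_Suc sum.atMost_Suc)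
  also have "\<dots> = (\<Sum>k\<le>n. - int (Suc n) * (int (n choose k) * (- 1) ^ k * w (Suc k)))"
  proof (intro sum.cong refl)
    fix k
    have "int (Suc n choose Suc k) * int (Suc k) = int (Suc n) * int (n choose k)"
      using Suc_times_binomial_eq[of n k] by (metis of_nat_mult)
    then show "int (Suc n choose Suc k) * (- 1) ^ Suc k * (int (Suc k) * w (Suc k)) =
        - int (Suc n) * (int (n choose k) * (- 1) ^ k * w (Suc k))"
      by (simp add: algebra_simps del: binomial_Suc_Suc of_nat_Suc)
  qed
  finally show ?thesis
    by (simp add: altsum_def sum_distrib_left)
qed

section \<open>Linear functionals on integer polynomials\<close>

text \<open>An integer sequence \<open>w\<close> is regarded as the linear functional sending \<open>x ^ k\<close> to \<open>w k\<close>,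
  so that \<open>altsum n w\<close> is its value at \<open>(1 - x) ^ n\<close>.\<close>

definition pairing :: "(nat \<Rightarrow> int) \<Rightarrow> int poly \<Rightarrow> int" where
  "pairing w F = (\<Sum>k\<le>degree F. coeff F k * w k)"

lemma pairing_eq_sum:
  assumes "degree F \<le> N"
  shows "pairing w F = (\<Sum>k\<le>N. coeff F k * w k)"
  unfolding pairing_def using assms
  by (intro sum.mono_neutral_left) (auto simp: coeff_eq_0)

lemma pairing_add: "pairing w (F + G) = pairing w F + pairing w G"
proof -
  let ?N = "max (degree F) (degree G)"
  have "pairing w (F + G) = (\<Sum>k\<le>?N. coeff (F + G) k * w k)"
    by (intro pairing_eq_sum degree_add_le_max)
  also have "\<dots> = pairing w F + pairing w G"
    by (simp add: pairing_eq_sum[of F ?N] pairing_eq_sum[of G ?N] sum.distrib distrib_right)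
  finally show ?thesis .
qed

lemma pairing_smult: "pairing w (smult c F) = c * pairing w F"
  using pairing_eq_sum[of "smult c F" "degree F" w]
  by (simp add: degree_smult_le pairing_def sum_distrib_left mult.assoc)

lemma pairing_sum: "pairing w (\<Sum>i\<in>A. F i) = (\<Sum>i\<in>A. pairing w (F i))"
  by (induction A rule: infinite_finite_induct) (simp_all add: pairing_add, simp_all add: pairing_def)

lemma pairing_monom: "pairing w (monom c k) = c * w k"
  using pairing_eq_sum[of "monom c k" k w]
  by (simp add: degree_monom_le if_distrib[of "\<lambda>x. x * _"] cong: if_cong)

lemma one_minus_monom_power:
  "(1 - monom 1 s) ^ n = (\<Sum>k\<le>n. monom (int (n choose k) * (- 1) ^ k) (s * k))"
proof -
  have "(1 - monom 1 s) ^ n = (- monom 1 s + (1 :: int poly)) ^ n"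
    by simp
  also have "\<dots> = (\<Sum>k\<le>n. of_nat (n choose k) * (- monom 1 s) ^ k)"
    unfolding binomial_ring by simp
  also have "\<dots> = (\<Sum>k\<le>n. monom (int (n choose k) * (- 1) ^ k) (s * k))"
  proof (intro sum.cong refl)
    fix k
    have "(- monom 1 s :: int poly) ^ k = monom ((- 1) ^ k) (s * k)"
      by (simp add: minus_monom monom_power mult.commute)
    then show "of_nat (n choose k) * (- monom 1 s) ^ k = monom (int (n choose k) * (- 1) ^ k) (s * k)"
      by (simp add: of_nat_poly smult_monom)
  qed
  finally show ?thesis .
qed

lemma pairing_monom_times_power:
  "pairing w (monom c u * (1 - monom 1 s) ^ n) = c * altsum n (\<lambda>k. w (u + s * k))"
  by (simp add: one_minus_monom_power sum_distrib_left mult_monom pairing_sum pairing_monom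
      altsum_def mult.assoc)

lemma altsum_eq_pairing: "altsum n w = pairing w ((1 - monom 1 1) ^ n)"
  using pairing_monom_times_power[of w 1 0 1 n] by simp

text \<open>By linearity only the monomials of \<open>H\<close> matter. The scalar \<open>c\<close>
  stays inside the hypothesis because \<open>d\<close> may divide the product without dividing
  either factor.\<close>

lemma dvd_pairing_times_power:
  assumes "\<And>u. d dvd c * altsum n (\<lambda>k. w (u + s * k))"
  shows "d dvd c * pairing w (H * (1 - monom 1 s) ^ n)"
proof -
  have "pairing w (H * (1 - monom 1 s) ^ n) =
      pairing w ((\<Sum>u\<le>degree H. monom (coeff H u) u) * (1 - monom 1 s) ^ n)"
    by (simp only: poly_as_sum_of_monoms)
  also have "\<dots> = (\<Sum>u\<le>degree H. coeff H u * altsum n (\<lambda>k. w (u + s * k)))"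
    by (simp add: sum_distrib_right pairing_sum pairing_monom_times_power)
  finally have "c * pairing w (H * (1 - monom 1 s) ^ n) =
      (\<Sum>u\<le>degree H. coeff H u * (c * altsum n (\<lambda>k. w (u + s * k))))"
    by (simp add: sum_distrib_left mult.left_commute)
  then show ?thesis
    using assms by (auto intro!: dvd_sum)
qed

lemma one_minus_X_power_prime:
  assumes "prime p"
  obtains h :: "int poly" where "(1 - monom 1 1) ^ p = 1 - monom 1 p + smult (int p) h"
proof -
  have "[:int p:] dvd (1 - monom 1 1) ^ p - (1 - monom 1 p)"
    unfolding const_poly_dvd_iff
  proof
    fix k
    have c: "coeff ((1 - monom 1 1) ^ p) k = int (p choose k) * (- 1) ^ k"
      by (simp add: one_minus_monom_power coeff_sum sum.delta binomial_eq_0)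
    consider "k = 0" | "k = p" | "p < k" | "0 < k" "k < p"
      by linarith
    then show "int p dvd coeff ((1 - monom 1 1) ^ p - (1 - monom 1 p)) k"
    proof cases
      case 2
      \<comment> \<open>The coefficient at \<open>p\<close> is \<open>(- 1) ^ p + 1\<close>, which
        is 0 for odd \<open>p\<close> and 2 for \<open>p = 2\<close>.\<close>
      have "p = 2 \<or> odd p"
        using assms by (metis primes_dvd_imp_eq two_is_prime_nat)
      then show ?thesis
        using 2 c assms by (auto simp: coeff_diff coeff_1 prime_gt_0_nat)
    next
      case 4
      then have "p dvd p choose k"
        using assms by (intro dvd_choose_prime) auto
      then have "int p dvd int (p choose k) * (- 1) ^ k"
        by (intro dvd_mult2) simp
      then show ?thesis
        using 4 c by (simp add: coeff_diff coeff_1)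
    qed (use c assms in \<open>auto simp: coeff_diff coeff_1 prime_gt_0_nat binomial_eq_0\<close>)
  qed
  then obtain h where "(1 - monom 1 1) ^ p - (1 - monom 1 p) = [:int p:] * h"
    by (auto elim: dvdE)
  then have "(1 - monom 1 1) ^ p = 1 - monom 1 p + smult (int p) h"
    by (simp add: algebra_simps)
  then show thesis
    by (rule that)
qed

text \<open>Writing \<open>n = p m + s\<close>, expand
  \<open>(1 - x) ^ n = (1 - x) ^ s * ((1 - x ^ p) + p h) ^ m\<close> in powers of \<open>1 - x ^ p\<close>.\<close>

lemma dvd_altsum_prime_expansion:
  assumes "prime p"
    and dvd: "\<And>i u. i \<le> n div p \<Longrightarrow>
      d dvd int (n div p choose i) * int p ^ i * altsum (n div p - i) (\<lambda>j. w (u + p * j))"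
  shows "d dvd altsum n w"
proof -
  define m where "m = n div p"
  define G :: "int poly" where "G = (1 - monom 1 1) ^ (n mod p)"
  obtain h :: "int poly" where h: "(1 - monom 1 1) ^ p = 1 - monom 1 p + smult (int p) h"
    using one_minus_X_power_prime[OF assms(1)] .
  have "(1 - monom 1 1 :: int poly) ^ n = ((1 - monom 1 1) ^ p) ^ m * G"
    unfolding m_def G_def by (simp add: power_mult[symmetric] power_add[symmetric])
  also have "((1 - monom 1 1) ^ p) ^ m = (smult (int p) h + (1 - monom 1 p)) ^ m"
    by (simp only: h add.commute[of "smult (int p) h"])
  also have "\<dots> * G = (\<Sum>i\<le>m. smult (int (m choose i) * int p ^ i)
      (h ^ i * G * (1 - monom 1 p) ^ (m - i)))"
    unfolding binomial_ring sum_distrib_right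
    by (intro sum.cong refl) (simp add: of_nat_poly smult_power mult_ac)
  finally have "altsum n w = (\<Sum>i\<le>m. (int (m choose i) * int p ^ i) *
      pairing w (h ^ i * G * (1 - monom 1 p) ^ (m - i)))"
    by (simp add: altsum_eq_pairing pairing_sum pairing_smult)
  moreover have "d dvd (int (m choose i) * int p ^ i) *
      pairing w (h ^ i * G * (1 - monom 1 p) ^ (m - i))" if "i \<le> m" for i
    using that by (intro dvd_pairing_times_power) (simp add: m_def dvd)
  ultimately show ?thesis
    by (auto intro!: dvd_sum)
qed

section \<open>Sums over a residue class\<close>

text \<open>Extending the weight by zero outside the residue class allows sums over all
  \<open>k \<le> n\<close>; inside the class the division is exact.\<close>

definition residue_power :: "nat \<Rightarrow> int \<Rightarrow> nat \<Rightarrow> nat \<Rightarrow> int" where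
  "residue_power q r l k =
    (if [int k = r] (mod int q) then ((int k - r) div int q) ^ l else 0)"

lemma residue_power_Suc_index: "residue_power q r l (Suc k) = residue_power q (r - 1) l k"
proof -
  have "[int (Suc k) = r] (mod int q) \<longleftrightarrow> [int k = r - 1] (mod int q)"
    by (simp add: cong_iff_dvd_diff algebra_simps)
  then show ?thesis
    by (simp add: residue_power_def algebra_simps)
qed

text \<open>On the residue class \<open>k = q * ((k - r) / q) + r\<close>, so multiplication by the
  index trades for a higher exponent \<open>l\<close>.\<close>

lemma index_mult_residue_power:
  "int k * residue_power q r l k =
    int q * residue_power q r (Suc l) k + r * residue_power q r l k"
proof (cases "[int k = r] (mod int q)")
  case True
  then have "int k = int q * ((int k - r) div int q) + r"
    by (simp add: cong_iff_dvd_diff)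
  then have "int k * residue_power q r l k =
      (int q * ((int k - r) div int q) + r) * residue_power q r l k"
    by simp
  then show ?thesis
    using True by (simp add: residue_power_def algebra_simps)
qed (simp add: residue_power_def)

lemma altsum_residue_power_recurrence:
  "r * altsum (Suc n) (residue_power q r l) =
    - int (Suc n) * altsum n (residue_power q (r - 1) l)
    - int q * altsum (Suc n) (residue_power q r (Suc l))"
  using altsum_index_mult[of n "residue_power q r l"]
  unfolding index_mult_residue_power altsum_add altsum_cmult residue_power_Suc_index
  by linarith

section \<open>Factorial divisors of the residue-class sums\<close>

text \<open>For modulus 1 the recurrence expresses exponent \<open>l + 1\<close> through exponent
  \<open>l\<close>. At \<open>l = 0\<close> the sum is \<open>(1 - 1) ^ n\<close>, which vanishes
  unless \<open>n = 0\<close>.\<close>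

lemma fact_dvd_altsum_residue_power: "fact n dvd altsum n (residue_power 1 r l)"
proof (induction l arbitrary: n r)
  case 0
  have w: "residue_power 1 r 0 = (\<lambda>_. 1)"
    by (simp add: residue_power_def fun_eq_iff)
  have "altsum n (residue_power 1 r 0) = 0" if "n > 0"
    using choose_alternating_sum[OF that, where ?'a = int] unfolding w altsum_def
    by (simp add: mult.commute)
  then show ?case
    by (cases "n = 0") simp_all
next
  case (Suc l)
  show ?case
  proof (cases n)
    case (Suc n')
    have "fact n dvd int n * altsum n' (residue_power 1 (r - 1) l)"
      using Suc.IH[of n' "r - 1"] Suc by (simp add: mult_dvd_mono del: of_nat_Suc)
    moreover have "fact n dvd r * altsum n (residue_power 1 r l)"
      using Suc.IH by simp
    ultimately have "fact n dvd - int n * altsum n' (residue_power 1 (r - 1) l)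
        - r * altsum n (residue_power 1 r l)"
      by simp
    also have "\<dots> = altsum n (residue_power 1 r (Suc l))"
      using altsum_residue_power_recurrence[of r n' 1 l] Suc by simp
    finally show ?thesis .
  qed simp
qed

text \<open>Along the progression \<open>u + p * j\<close> the condition modulo \<open>p * q\<close>
  either never holds or becomes one on \<open>j\<close> modulo \<open>q\<close> with the same
  quotient. This is how the expansion lowers \<open>\<alpha>\<close> by one.\<close>

lemma residue_power_mult_modulus:
  assumes "p > 0"
  shows "(\<lambda>j. residue_power (p * q) r l (u + p * j)) =
    (if int p dvd r - int u then residue_power q ((r - int u) div int p) l else (\<lambda>_. 0))"
proof (cases "int p dvd r - int u")
  case True
  then obtain t where t: "r - int u = int p * t"
    by blast
  have diff: "int (u + p * j) - r = int p * (int j - t)" for j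
    using t by (simp add: algebra_simps)
  show ?thesis
    using assms True unfolding residue_power_def cong_iff_dvd_diff diff t
    by (simp add: fun_eq_iff)
next
  case False
  have not_cong: "\<not> [int (u + p * j) = r] (mod int (p * q))" for j
  proof
    assume "[int (u + p * j) = r] (mod int (p * q))"
    then have "int p dvd int (u + p * j) - r"
      unfolding cong_iff_dvd_diff of_nat_mult by (rule dvd_mult_left)
    then have "int p dvd int (u + p * j) - r - int p * int j"
      by (rule dvd_diff) simp
    then have "int p dvd - (r - int u)"
      by simp
    then show False
      using False unfolding dvd_minus_iff by contradiction
  qed
  then show ?thesis
    by (simp only: residue_power_def not_cong False if_False)
qed

text \<open>As \<open>m\<close> grows from \<open>k\<close>, the quotient \<open>m div q\<close>
  changes only at multiples of \<open>q\<close>; there the new factor of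
  \<open>fact (m div q)\<close> divides the new factor of \<open>fact m\<close>.\<close>

lemma fact_div_dvd_fact_div_ratio:
  fixes k m q :: nat
  assumes "k \<le> m" "q > 0"
  shows "fact (m div q) * fact k dvd (fact m * fact (k div q) :: int)"
  using assms(1)
proof (induction m rule: dec_induct)
  case (step m)
  show ?case
  proof (cases "q dvd Suc m")
    case True
    then have d: "Suc m div q = Suc (m div q)"
      by (rule div_Suc_dvd)
    have "int (Suc (m div q)) dvd int (Suc m)"
      using True d by (metis dvd_mult_div_cancel dvd_triv_right int_dvd_int_iff)
    then have "int (Suc (m div q)) * (fact (m div q) * fact k) dvd
        int (Suc m) * (fact m * fact (k div q))"
      using step.IH by (rule mult_dvd_mono)
    then show ?thesis
      unfolding d fact_Suc mult.assoc .
  next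
    case False
    then have "Suc m div q = m div q"
      by (rule div_Suc_not_dvd)
    then show ?thesis
      using step.IH by (simp add: mult.assoc)
  qed
qed simp

text \<open>Passing from \<open>m\<close> to \<open>m - i\<close> costs at most the factor \<open>i! * (m choose i)\<close> in the factorial,
  which is compensated by the factor \<open>p ^ i * (m choose i)\<close> of the expansion.\<close>

lemma multiplicity_fact_div_le:
  assumes "prime p" "i \<le> m" "q > 0"
  shows "multiplicity (int p) (fact (m div q)) \<le>
    multiplicity (int p) (int (m choose i) * int p ^ i) + multiplicity (int p) (fact ((m - i) div q))"
proof -
  let ?v = "multiplicity (int p)"
  have pos: "int (m choose i) \<noteq> 0"
    using assms(2) by simp
  have p: "prime_elem (int p)" "int p \<noteq> 0"
    using assms(1) by auto
  have "fact m = (fact i * fact (m - i) * int (m choose i))"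
    using binomial_fact_lemma[OF assms(2)] by (metis of_nat_fact of_nat_mult)
  moreover have "?v (fact (m div q) * fact (m - i)) \<le> ?v (fact m * fact ((m - i) div q))"
    using fact_div_dvd_fact_div_ratio[of "m - i" m q] assms(3)
    by (intro dvd_imp_multiplicity_le) auto
  ultimately have "?v (fact (m div q)) \<le>
      ?v (fact i) + ?v (int (m choose i)) + ?v (fact ((m - i) div q))"
    using assms(1) pos by (simp add: multiplicity_mult_int)
  moreover have "?v (int (m choose i) * int p ^ i) = ?v (int (m choose i)) + i"
    using assms(1) pos p by (simp add: multiplicity_mult_int)
  ultimately show ?thesis
    using multiplicity_fact_le[OF assms(1), of i] by linarith
qed

lemma fact_part_dvd_altsum_residue_power:
  assumes "prime p"
  shows "int p ^ multiplicity (int p) (fact (n div p ^ \<alpha>)) dvd altsum n (residue_power (p ^ \<alpha>) r l)"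
proof (induction \<alpha> arbitrary: n r)
  case 0
  show ?case
    using dvd_trans[OF multiplicity_dvd fact_dvd_altsum_residue_power] by simp
next
  case (Suc \<alpha>)
  define m where "m = n div p"
  have p: "p > 0"
    using assms by (rule prime_gt_0_nat)
  have div: "n div p ^ Suc \<alpha> = m div p ^ \<alpha>"
    by (simp add: m_def div_mult2_eq)
  show ?case
    unfolding div
  proof (rule dvd_altsum_prime_expansion[OF assms], fold m_def)
    fix i u
    assume i: "i \<le> m"
    let ?c = "int (m choose i) * int p ^ i"
    let ?a = "altsum (m - i) (\<lambda>j. residue_power (p ^ Suc \<alpha>) r l (u + p * j))"
    have "int p ^ multiplicity (int p) (fact ((m - i) div p ^ \<alpha>)) dvd ?a"
      using Suc.IH[of "m - i"] p
      by (simp add: residue_power_mult_modulus altsum_def)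
    then have "int p ^ (multiplicity (int p) ?c + multiplicity (int p) (fact ((m - i) div p ^ \<alpha>)))
        dvd ?c * ?a"
      unfolding power_add by (intro mult_dvd_mono multiplicity_dvd)
    then show "int p ^ multiplicity (int p) (fact (m div p ^ \<alpha>)) dvd ?c * ?a"
      using multiplicity_fact_div_le[OF assms i, of "p ^ \<alpha>"] p
      by (meson power_le_dvd zero_less_power)
  qed
qed

section \<open>The carry term\<close>

text \<open>An order below \<open>\<alpha>\<close> is determined by the residue modulo
  \<open>p ^ \<alpha>\<close>.\<close>

lemma multiplicity_cong_prime_power:
  fixes x y :: int
  assumes "prime p" "[x = y] (mod int p ^ \<alpha>)" "\<not> int p ^ \<alpha> dvd x"
  shows "multiplicity (int p) x = multiplicity (int p) y"
proof -
  have x: "x \<noteq> 0"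
    using assms(3) by auto
  have less: "multiplicity (int p) x < \<alpha>"
    using assms(3) dvd_power_iff_le_multiplicity[OF assms(1) x] by simp
  have iff: "int p ^ a dvd x \<longleftrightarrow> int p ^ a dvd y" if "a \<le> \<alpha>" for a
    using cong_dvd_modulus[OF assms(2) le_imp_power_dvd[OF that]] by (rule cong_dvd_iff)
  have "int p ^ multiplicity (int p) x dvd y"
    using iff[of "multiplicity (int p) x"] less by (simp add: multiplicity_dvd)
  moreover have "\<not> int p ^ Suc (multiplicity (int p) x) dvd y"
    using iff[of "Suc (multiplicity (int p) x)"] less dvd_power_iff_le_multiplicity[OF assms(1) x]
    by (simp del: power_Suc)
  ultimately show ?thesis
    by (rule multiplicity_eqI[symmetric])
qed

lemma int_least_residue: "m > 0 \<Longrightarrow> int (least_residue a m) = a mod int m"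
  by (simp add: least_residue_def)

text \<open>The sum \<open>s\<close> is congruent to \<open>Suc n\<close> modulo
  \<open>p ^ \<alpha>\<close> and lies strictly between 0 and \<open>2 * p ^ \<alpha>\<close>. If
  \<open>p ^ \<alpha>\<close> divides \<open>Suc n\<close>, then \<open>s = p ^ \<alpha>\<close> and
  the cofactor is the new factor of the factorial; otherwise the quotient is unchanged and the two
  orders agree.\<close>

lemma multiplicity_residue_sum:
  fixes r :: int and n \<alpha> :: nat
  assumes "prime p" and pos: "least_residue r (p ^ \<alpha>) > 0"
  defines "s \<equiv> least_residue r (p ^ \<alpha>) + least_residue (int (Suc n) - r) (p ^ \<alpha>)"
  shows "multiplicity (int p) (fact (Suc n div p ^ \<alpha>)) + multiplicity (int p) (int s) =
    multiplicity (int p) (int (Suc n)) + multiplicity (int p) (fact (n div p ^ \<alpha>))"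
proof -
  let ?q = "p ^ \<alpha>"
  have q: "?q > 0"
    using assms(1) prime_gt_0_nat by simp
  then have q': "int ?q > 0"
    by (simp only: of_nat_0_less_iff)
  have r1: "int (least_residue r ?q) = r mod int ?q"
    and r2: "int (least_residue (int (Suc n) - r) ?q) = (int (Suc n) - r) mod int ?q"
    using int_least_residue[OF q] by blast+
  have s_eq: "int s = r mod int ?q + (int (Suc n) - r) mod int ?q"
    unfolding s_def using r1 r2 by simp
  have cong: "[int s = int (Suc n)] (mod int ?q)"
    unfolding s_eq cong_def by (simp add: mod_add_eq)
  show ?thesis
  proof (cases "?q dvd Suc n")
    case True
    have "int s < int (2 * ?q)"
      unfolding of_nat_mult s_eq of_nat_numeral
      using pos_mod_bound[OF q', of r] pos_mod_bound[OF q', of "int (Suc n) - r"] by linarith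
    then have "s < 2 * ?q"
      by (simp only: of_nat_less_iff)
    moreover have "int ?q dvd int s"
      using cong True by (metis cong_dvd_iff int_dvd_int_iff)
    then obtain t where t: "s = ?q * t"
      using int_dvd_int_iff by blast
    moreover have "s > 0"
      using pos unfolding s_def by simp
    ultimately have "t = 1"
      using q by (cases t) (auto simp: mult.commute[of 2])
    then have s: "s = ?q"
      using t by simp
    have d: "Suc n div ?q = Suc (n div ?q)"
      using True by (rule div_Suc_dvd)
    then have "int (Suc n) = int ?q * int (Suc (n div ?q))"
      using True by (metis dvd_mult_div_cancel of_nat_mult)
    then have "multiplicity (int p) (int (Suc n)) =
        multiplicity (int p) (int ?q) + multiplicity (int p) (int (Suc (n div ?q)))"
      using multiplicity_mult_int[OF assms(1), of "int ?q" "int (Suc (n div ?q))"] q by simp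
    moreover have "multiplicity (int p) (fact (Suc (n div ?q))) =
        multiplicity (int p) (int (Suc (n div ?q))) + multiplicity (int p) (fact (n div ?q))"
      using multiplicity_mult_int[OF assms(1), of "int (Suc (n div ?q))" "fact (n div ?q)"] by simp
    ultimately show ?thesis
      unfolding d s by simp
  next
    case False
    then have "Suc n div ?q = n div ?q"
      by (rule div_Suc_not_dvd)
    moreover have "\<not> int p ^ \<alpha> dvd int (Suc n)"
      using False by (metis int_dvd_int_iff of_nat_power)
    then have "multiplicity (int p) (int (Suc n)) = multiplicity (int p) (int s)"
      using assms(1) cong by (intro multiplicity_cong_prime_power[of p _ _ \<alpha>]) (auto simp: cong_sym)
    ultimately show ?thesis
      by simp
  qed
qed

definition carry_order :: "nat \<Rightarrow> nat \<Rightarrow> nat \<Rightarrow> int \<Rightarrow> nat" where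
  "carry_order p \<alpha> n r = multiplicity (int p)
    (int ((least_residue r (p ^ \<alpha>) + least_residue (int n - r) (p ^ \<alpha>)) choose least_residue r (p ^ \<alpha>)))"

text \<open>Passing from \<open>(Suc n, r)\<close> to \<open>(n, r - 1)\<close> lowers the first
  residue by one and keeps the second, so the absorption identity for binomial coefficients applies.
  The outcome is the exponent balance of the first term in the recurrence for
  \<open>r * S\<close>.\<close>

lemma carry_order_Suc:
  fixes r :: int
  assumes "prime p" and pos: "least_residue r (p ^ \<alpha>) > 0"
  shows "multiplicity (int p) (fact (Suc n div p ^ \<alpha>)) + carry_order p \<alpha> (Suc n) r + multiplicity (int p) r =
    multiplicity (int p) (int (Suc n)) + multiplicity (int p) (fact (n div p ^ \<alpha>))
      + carry_order p \<alpha> n (r - 1)"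
proof -
  let ?q = "p ^ \<alpha>"
  let ?v = "multiplicity (int p)"
  define a where "a = least_residue r ?q - 1"
  define b where "b = least_residue (int (Suc n) - r) ?q"
  have q: "?q > 0"
    using assms(1) prime_gt_0_nat by simp
  have a: "least_residue r ?q = Suc a"
    using pos by (simp add: a_def)
  then have r_mod: "r mod int ?q = int (Suc a)"
    using int_least_residue[OF q, of r] by simp
  have "least_residue (r - 1) ?q = a"
  proof -
    have "int (Suc a) < int ?q"
      using r_mod q by (metis of_nat_0_less_iff pos_mod_bound)
    moreover have "(r - 1) mod int ?q = (int (Suc a) - 1) mod int ?q"
      by (metis r_mod mod_diff_left_eq)
    ultimately show ?thesis
      by (simp add: least_residue_def del: of_nat_power)
  qed
  moreover have "least_residue (int n - (r - 1)) ?q = b"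
    by (simp add: b_def algebra_simps)
  ultimately have order_pred: "carry_order p \<alpha> n (r - 1) = ?v (int ((a + b) choose a))"
    by (simp add: carry_order_def)
  have "int (Suc a) * int (Suc (a + b) choose Suc a) = int (Suc (a + b)) * int ((a + b) choose a)"
    by (metis Suc_times_binomial of_nat_mult)
  then have "?v (int (Suc a)) + ?v (int (Suc (a + b) choose Suc a)) =
      ?v (int (Suc (a + b))) + ?v (int ((a + b) choose a))"
    using multiplicity_mult_int[OF assms(1), of "int (Suc a)" "int (Suc (a + b) choose Suc a)"]
      multiplicity_mult_int[OF assms(1), of "int (Suc (a + b))" "int ((a + b) choose a)"]
    by (simp del: binomial_Suc_Suc of_nat_Suc)
  moreover have "carry_order p \<alpha> (Suc n) r = ?v (int (Suc (a + b) choose Suc a))"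
    unfolding carry_order_def a b_def[symmetric] by simp
  moreover have "?v r = ?v (int (Suc a))"
  proof (rule multiplicity_cong_prime_power[OF assms(1)])
    show "[r = int (Suc a)] (mod int p ^ \<alpha>)"
      using r_mod unfolding cong_def by (metis mod_mod_trivial of_nat_power)
    show "\<not> int p ^ \<alpha> dvd r"
      using r_mod by (simp add: dvd_eq_mod_eq_0)
  qed
  moreover have "?v (fact (Suc n div ?q)) + ?v (int (Suc (a + b))) =
      ?v (int (Suc n)) + ?v (fact (n div ?q))"
    using multiplicity_residue_sum[OF assms, of n] unfolding a b_def[symmetric] by simp
  ultimately show ?thesis
    using order_pred by linarith
qed

section \<open>The combined factorial and carry bound\<close>

lemma carry_order_dvd_altsum_residue_power:
  assumes "prime p"
  shows "int p ^ (multiplicity (int p) (fact (n div p ^ \<alpha>)) + carry_order p \<alpha> n r)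
    dvd altsum n (residue_power (p ^ \<alpha>) r l)"
proof (induction n arbitrary: r l)
  let ?q = "p ^ \<alpha>"
  let ?v = "multiplicity (int p)"
  let ?S = "\<lambda>n r l. altsum n (residue_power ?q r l)"
  have q: "?q > 0"
    using assms prime_gt_0_nat by simp
  \<comment> \<open>With residue zero the binomial coefficient is 1, so the factorial bound is
    already the full claim.\<close>
  have zero_case: "int p ^ (?v (fact (n div ?q)) + carry_order p \<alpha> n r) dvd ?S n r l"
    if "least_residue r ?q = 0" for n r l
    using that fact_part_dvd_altsum_residue_power[OF assms, of n \<alpha> r l]
    by (simp add: carry_order_def)
  {
    case 0
    show ?case
    proof (cases "least_residue r ?q = 0")
      case False
      then have "\<not> int ?q dvd r"
        unfolding least_residue_def by (auto simp: dvd_eq_mod_eq_0 simp del: of_nat_power)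
      \<comment> \<open>For \<open>n = 0\<close> the only index is \<open>k = 0\<close>, which lies
        outside the residue class.\<close>
      then have "?S 0 r l = 0"
        by (simp add: altsum_def residue_power_def cong_iff_dvd_diff)
      then show ?thesis
        by simp
    qed (rule zero_case)
  next
    case (Suc n)
    let ?c = "?v (fact (Suc n div ?q)) + carry_order p \<alpha> (Suc n) r"
    show ?case
    proof (cases "least_residue r ?q = 0")
      case False
      then have ndvd: "\<not> int p ^ \<alpha> dvd r"
        unfolding least_residue_def by (auto simp: dvd_eq_mod_eq_0)
      then have r: "r \<noteq> 0"
        by auto
      have v_r: "?v r < \<alpha>"
        using ndvd dvd_power_iff_le_multiplicity[OF assms r] by simp
      \<comment> \<open>The extra \<open>?v r\<close> pays for cancelling \<open>r\<close> later,
        leaving the target exponent \<open>?c\<close>.\<close>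
      have first: "int p ^ (?c + ?v r) dvd int (Suc n) * ?S n (r - 1) l" for l
      proof -
        have "?c + ?v r = ?v (int (Suc n)) + (?v (fact (n div ?q)) + carry_order p \<alpha> n (r - 1))"
          using carry_order_Suc[OF assms, of r \<alpha> n] False by simp
        then show ?thesis
          using Suc.IH[of "r - 1" l]
          by (simp only: power_add[of "int p" "?v (int (Suc n))"])
            (intro mult_dvd_mono multiplicity_dvd)
      qed
      \<comment> \<open>In the recurrence the term with \<open>l + 1\<close> has the factor \<open>p ^ \<alpha> / r\<close>, divisible by \<open>p\<close>; so
        any divisibility valid for all \<open>l\<close> can be improved by a factor \<open>p\<close> until the first term
        becomes the obstruction.\<close>
      have "int p ^ min ?c (?v (fact (Suc n div ?q)) + t) dvd ?S (Suc n) r l" for t l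
      proof (induction t arbitrary: l)
        case 0
        show ?case
          using fact_part_dvd_altsum_residue_power[OF assms, of "Suc n" \<alpha> r l] by simp
      next
        case (Suc t)
        let ?k = "min ?c (?v (fact (Suc n div ?q)) + t)"
          and ?k' = "min ?c (?v (fact (Suc n div ?q)) + Suc t)"
        have "int p ^ (\<alpha> + ?k) dvd int ?q * ?S (Suc n) r (Suc l)"
          using Suc.IH[of "Suc l"] unfolding power_add of_nat_power by (intro mult_dvd_mono) auto
        moreover have "?k' + ?v r \<le> \<alpha> + ?k"
          using v_r by linarith
        ultimately have "int p ^ (?k' + ?v r) dvd int ?q * ?S (Suc n) r (Suc l)"
          by (rule power_le_dvd)
        moreover have "int p ^ (?k' + ?v r) dvd int (Suc n) * ?S n (r - 1) l"
          using first[of l] by (rule power_le_dvd) simp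
        ultimately have "int p ^ (?k' + ?v r) dvd
            - int (Suc n) * ?S n (r - 1) l - int ?q * ?S (Suc n) r (Suc l)"
          by (intro dvd_diff) (simp_all only: mult_minus_left dvd_minus_iff)
        then have dvd: "int p ^ (?k' + ?v r) dvd r * ?S (Suc n) r l"
          unfolding altsum_residue_power_recurrence .
        show ?case
        \<comment> \<open>Cancelling \<open>r\<close> compares orders, which requires a nonzero
          sum.\<close>
        proof (cases "?S (Suc n) r l = 0")
          case False
          then have "?k' + ?v r \<le> ?v r + ?v (?S (Suc n) r l)"
            using dvd r dvd_power_iff_le_multiplicity[OF assms, of "r * ?S (Suc n) r l"]
            by (simp add: multiplicity_mult_int[OF assms])
          then show ?thesis
            using dvd_power_iff_le_multiplicity[OF assms False] by simp
        qed simp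
      qed
      \<comment> \<open>For this \<open>t\<close> both arguments of the minimum equal
        \<open>?c\<close>.\<close>
      from this[of "carry_order p \<alpha> (Suc n) r"] show ?thesis
        by simp
    qed (rule zero_case)
  }
qed

section \<open>Passage to extended orders and counted carries\<close>

theorem theorem5p1:
  fixes p \<alpha> l n :: nat and r :: int
  assumes "prime p"
  shows "ereal_of_enat (ordp p (\<Sum>k | k \<le> n \<and> [int k = r] (mod int (p ^ \<alpha>)).
              int (n choose k) * (- 1) ^ k * ((int k - r) div int (p ^ \<alpha>)) ^ l))
           - ereal_of_enat (ordp p (fact (n div p ^ \<alpha>)))
         \<ge> ereal_of_enat (enat (num_carries p (least_residue r (p ^ \<alpha>))
              (least_residue (int n - r) (p ^ \<alpha>))))
       \<and> enat (num_carries p (least_residue r (p ^ \<alpha>)) (least_residue (int n - r) (p ^ \<alpha>)))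
         = ordp p (int ((least_residue r (p ^ \<alpha>) + least_residue (int n - r) (p ^ \<alpha>))
              choose least_residue r (p ^ \<alpha>)))"
proof -
  let ?q = "p ^ \<alpha>"
  let ?a = "least_residue r ?q" and ?b = "least_residue (int n - r) ?q"
  define S where "S = (\<Sum>k | k \<le> n \<and> [int k = r] (mod int ?q).
    int (n choose k) * (- 1) ^ k * ((int k - r) div int ?q) ^ l)"
  define v where "v = multiplicity (int p) (fact (n div ?q))"
  have carries: "num_carries p ?a ?b = carry_order p \<alpha> n r"
    unfolding carry_order_def by (rule kummer[OF assms])
  have "altsum n (residue_power ?q r l) = S"
    unfolding altsum_def residue_power_def S_def
    by (rule sum.mono_neutral_cong_right) auto
  then have dvd: "int p ^ (v + carry_order p \<alpha> n r) dvd S"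
    using carry_order_dvd_altsum_residue_power[OF assms, of n \<alpha> r l] by (simp add: v_def)
  have v: "ordp p (fact (n div ?q)) = enat v"
    unfolding v_def using assms by (rule ordp_eq_multiplicity) simp
  have "ereal_of_enat (enat (num_carries p ?a ?b)) \<le> ereal_of_enat (ordp p S) - ereal_of_enat (enat v)"
  \<comment> \<open>A vanishing sum has order \<open>\<infinity>\<close>, and subtracting the finite
    \<open>v\<close> leaves it infinite.\<close>
  proof (cases "S = 0")
    case False
    then have "v + carry_order p \<alpha> n r \<le> multiplicity (int p) S"
      using dvd dvd_power_iff_le_multiplicity[OF assms] by blast
    then have "real (carry_order p \<alpha> n r) \<le> real (multiplicity (int p) S) - real v"
      by linarith
    then show ?thesis
      by (simp add: ordp_eq_multiplicity[OF assms False] carries)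
  qed (simp add: ordp_zero)
  moreover have "enat (num_carries p ?a ?b) = ordp p (int ((?a + ?b) choose ?a))"
    unfolding kummer[OF assms] by (rule ordp_eq_multiplicity[symmetric, OF assms]) simp
  ultimately show ?thesis
    unfolding S_def[symmetric] v by blast
qed

end
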